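(* For every integer $n\ge1$, $H(n)=p(n)-n$ is the number of non-hook partitions of $n$. Equivalently, $$H(n)=\#\{\lambda\vdash n:\operatorname{Dur}(\lambda)\ge2\}.$$
   Context: $p(n)$ denotes the number of (unrestricted) partitions of the positive integer $n$, and $H(n):=p(n)-n$. A hook partition of $n$ is a partition of the form $(k,1^{\,n-k})$ with $1\le k\le n$ (one part equal to $k$ followed by $n-k$ parts equal to $1$); a non-hook partition is one not of this form. The Durfee square of a partition $\lambda$ is the largest square contained in its Ferrers diagram (anchored at the top-left corner); $\operatorname{Dur}(\lambda)$ denotes its side length, i.e. the largest $d$ such that $\lambda$ has at least $d$ parts that are $\ge d$. *)

theory Defs
  imports Main "HOL-Library.Multiset"
begin

text \<open>A partition is the multiset of its (positive) parts.\<close>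

definition partitions :: "nat \<Rightarrow> nat multiset set" where
  "partitions n = {M. 0 \<notin># M \<and> sum_mset M = n}"

lemma finite_partitions: "finite (partitions n)"
proof (rule finite_subset)
  have size_le: "size M \<le> sum_mset M" if "0 \<notin># M" for M :: "nat multiset"
    using that by (induction M) auto
  show "partitions n \<subseteq> mset ` {xs. set xs \<subseteq> {..n} \<and> length xs \<le> n}"
  proof
    fix M assume M: "M \<in> partitions n"
    obtain xs where xs: "mset xs = M" using ex_mset by blast
    have "set xs \<subseteq> {..n}"
      using M xs member_le_sum_list[of _ xs]
      by (auto simp: partitions_def sum_mset_sum_list)
    moreover have "length xs \<le> n"
      using M xs size_le[of M] by (auto simp: partitions_def)
    ultimately show "M \<in> mset ` {xs. set xs \<subseteq> {..n} \<and> length xs \<le> n}"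
      using xs by blast
  qed
  show "finite (mset ` {xs. set xs \<subseteq> {..n} \<and> length xs \<le> n})"
    by (intro finite_imageI finite_lists_length_le) simp
qed

definition p :: "nat \<Rightarrow> nat" where
  "p n = card (partitions n)"

text \<open>Integer-valued, so that the subtraction is not truncated.\<close>

definition H :: "nat \<Rightarrow> int" where
  "H n = int (p n) - int n"

definition is_hook :: "nat \<Rightarrow> nat multiset \<Rightarrow> bool" where
  "is_hook n M \<longleftrightarrow> (\<exists>k. 1 \<le> k \<and> k \<le> n \<and> M = add_mset k (replicate_mset (n - k) 1))"

text \<open>Side length of the Durfee square: a \<open>d \<times> d\<close> square anchored at the top-left corner
  fits into the Ferrers diagram iff at least \<open>d\<close> parts (rows) are \<open>\<ge> d\<close>.\<close>

definition Dur :: "nat multiset \<Rightarrow> nat" where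
  "Dur M = Max {d. d \<le> size (filter_mset (\<lambda>x. d \<le> x) M)}"

text \<open>The maximum is taken over a finite nonempty set.\<close>

lemma Dur_set_finite: "finite {d. d \<le> size (filter_mset (\<lambda>x. d \<le> x) M)}"
  by (rule finite_subset[of _ "{..size M}"])
     (auto intro: order_trans size_mset_mono)

lemma Dur_set_nonempty: "{d. d \<le> size (filter_mset (\<lambda>x. d \<le> x) M)} \<noteq> {}"
  by (auto intro: exI[of _ 0])

end

theory Submission
  imports Defs
begin

text \<open>A hook is a partition with at most one part exceeding 1 (\<open>is_hook_iff\<close>),
  whereas a Durfee square of side at least 2 means at least two parts exceeding 1
  (\<open>le_Dur_iff\<close> at \<open>d = 2\<close>). For \<open>n \<ge> 1\<close> the two
  conditions are therefore complementary. Each \<open>k\<close> from 1 to \<open>n\<close> gives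
  exactly one hook (\<open>card_hook_partitions\<close>), so discarding the hooks from the
  \<open>p n\<close> partitions leaves \<open>H n\<close> of them.\<close>

lemma le_Dur_iff: "d \<le> Dur M \<longleftrightarrow> d \<le> size (filter_mset (\<lambda>x. d \<le> x) M)"
proof -
  \<comment> \<open>Raising the threshold can only lose parts, so the set of sides of fitting
    squares is downward closed: being below its maximum is the same as belonging to it.\<close>
  have "size (filter_mset (\<lambda>x. e \<le> x) M) \<le> size (filter_mset (\<lambda>x. d \<le> x) M)" if "d \<le> e" for e
    using that by (intro size_mset_mono filter_mset_mono_strong) auto
  then have "(\<exists>e\<ge>d. e \<le> size (filter_mset (\<lambda>x. e \<le> x) M))
      \<longleftrightarrow> d \<le> size (filter_mset (\<lambda>x. d \<le> x) M)"
    by (meson order_refl order_trans)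
  then show ?thesis
    unfolding Dur_def by (subst Max_ge_iff[OF Dur_set_finite Dur_set_nonempty]) auto
qed

text \<open>Parts are positive, so those below 2 are all 1, and only the parts \<ge> 2 can spoil the
  hook shape. The assumption \<open>n \<ge> 1\<close> excludes the empty partition, which has no
  part \<ge> 2 and yet is not a hook.\<close>

lemma is_hook_iff:
  assumes M: "M \<in> partitions n" and n: "n \<ge> 1"
  shows "is_hook n M \<longleftrightarrow> size (filter_mset (\<lambda>x. 2 \<le> x) M) \<le> 1"
proof
  assume "is_hook n M"
  then obtain k where "M = {#k#} + replicate_mset (n - k) 1"
    by (auto simp: is_hook_def)
  moreover have "filter_mset (\<lambda>x. 2 \<le> x) (replicate_mset m (1::nat)) = {#}" for m
    by (induction m) auto
  ultimately have "filter_mset (\<lambda>x. 2 \<le> x) M = filter_mset (\<lambda>x. 2 \<le> x) {#k#}"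
    by (simp only: filter_union_mset add_0_right)
  then show "size (filter_mset (\<lambda>x. 2 \<le> x) M) \<le> 1"
    by simp
next
  assume le: "size (filter_mset (\<lambda>x. 2 \<le> x) M) \<le> 1"
  define m where "m = count M 1"
  have "filter_mset (\<lambda>x. \<not> 2 \<le> x) M = filter_mset (\<lambda>x. x = 1) M"
    using M by (intro filter_mset_cong) (auto simp: partitions_def not_le less_2_cases_iff)
  also have "\<dots> = replicate_mset m 1"
    unfolding m_def by (metis filter_eq_replicate_mset)
  finally have split: "M = filter_mset (\<lambda>x. 2 \<le> x) M + replicate_mset m 1"
    by (metis multiset_partition)
  have sum: "sum_mset M = n"
    using M by (simp add: partitions_def)
  consider "filter_mset (\<lambda>x. 2 \<le> x) M = {#}"
    | k where "filter_mset (\<lambda>x. 2 \<le> x) M = {#k#}"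
    using le by (metis One_nat_def le_Suc_eq le_zero_eq size_1_singleton_mset size_eq_0_iff_empty)
  then show "is_hook n M"
  proof cases
    case 1
    with split have eq: "M = replicate_mset m 1" by simp
    with sum have "m = n" by simp
    \<comment> \<open>The column of ones is the hook with \<open>k = 1\<close>: one of its ones,
      present because \<open>n \<ge> 1\<close>, plays the distinguished part.\<close>
    with eq n have "M = add_mset 1 (replicate_mset (n - 1) 1)"
      by (cases n) auto
    with n show ?thesis by (auto simp: is_hook_def)
  next
    case (2 k)
    with split have eq: "M = add_mset k (replicate_mset m 1)" by simp
    with sum have "k + m = n" by simp
    moreover have "2 \<le> k"
    proof -
      have "k \<in># filter_mset (\<lambda>x. 2 \<le> x) M" by (simp add: 2)
      then show ?thesis by simp
    qed
    ultimately show ?thesis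
      using eq unfolding is_hook_def by (intro exI[of _ k]) auto
  qed
qed

text \<open>Hooks are parametrized bijectively by \<open>k\<close> in \<open>{1..n}\<close>.\<close>

lemma card_hook_partitions: "card {M \<in> partitions n. is_hook n M} = n"
proof -
  let ?h = "\<lambda>k. add_mset k (replicate_mset (n - k) (1::nat))"
  have "inj_on ?h {1..n}"
  proof (rule inj_onI)
    fix k l assume kl: "k \<in> {1..n}" "l \<in> {1..n}" and "?h k = ?h l"
    \<comment> \<open>The number of parts, \<open>n - k + 1\<close>, already determines
      \<open>k\<close>; the bounds \<open>k \<le> n\<close> and \<open>l \<le> n\<close> keep the
      subtraction from truncating.\<close>
    then have "size (?h k) = size (?h l)" by (simp only:)
    then have "n - k = n - l" by simp
    with kl show "k = l" by auto
  qed
  moreover have "{M \<in> partitions n. is_hook n M} = ?h ` {1..n}"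
    by (auto simp: is_hook_def partitions_def split: if_splits)
  ultimately show ?thesis by (simp add: card_image)
qed

theorem proposition2p1:
  fixes n :: nat
  assumes "n \<ge> 1"
  shows "H n = int (card {M \<in> partitions n. \<not> is_hook n M})
    \<and> H n = int (card {M \<in> partitions n. Dur M \<ge> 2})"
proof -
  have "partitions n = {M \<in> partitions n. is_hook n M} \<union> {M \<in> partitions n. \<not> is_hook n M}"
    by blast
  then have "p n = card {M \<in> partitions n. is_hook n M} + card {M \<in> partitions n. \<not> is_hook n M}"
    unfolding p_def using finite_partitions[of n]
    by (subst card_Un_disjoint[symmetric]) auto
  then have "H n = int (card {M \<in> partitions n. \<not> is_hook n M})"
    by (simp add: H_def card_hook_partitions)
  \<comment> \<open>Both sides say that at least two parts are \<ge> 2.\<close>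
  moreover have "{M \<in> partitions n. \<not> is_hook n M} = {M \<in> partitions n. Dur M \<ge> 2}"
    using assms by (auto simp: is_hook_iff le_Dur_iff)
  ultimately show ?thesis by simp
qed

end
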